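(* Let $X$ and $Y$ be separable Hilbert spaces, let $Q$ be an injective, self-adjoint, positive, trace class operator on $Y$ with eigensystem $(\lambda_k, e_k)_{k\in\mathbb{N}}$, and let $K: X \to Y$ be a compact linear operator such that $KK^*$ is diagonalizable with respect to the eigenvectors $(e_k)_{k\in\mathbb{N}}$ of $Q$ and $Q^{-1/2}K$ is a Hilbert--Schmidt operator (in particular $\operatorname{ran}(K) \subseteq \operatorname{ran}(Q^{1/2})$). Define $$\Phi(u,y) = \sqrt{2}\sum_{k=1}^\infty \frac{|(y,e_k)_Y - (Ku,e_k)_Y| - |(y,e_k)_Y|}{\lambda_k^{1/2}}, \quad u \in X,\ y \in Y.$$ Then for every $y \in Y$ the function $u \mapsto \Phi(u,y)$ is Lipschitz continuous on $X$ with Lipschitz constant $\sqrt{2}\,\|Q^{-1/2}K\|_{\mathrm{HS}}$, independent of $y$. In particular, for every $y \in Y$, $\Phi(\cdot,y)$ is Lipschitz continuous on bounded sets and there exists $\underline{L} \ge 0$ such that $\Phi(u,y) \ge \Phi(0,y) - \underline{L}\|u\|_X$ for all $u \in X$.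
   Context: $\operatorname{ran}$ denotes the range; $\|\cdot\|_{\mathrm{HS}}$ is the Hilbert--Schmidt norm. An eigensystem $(\lambda_k,e_k)_{k\in\mathbb{N}}$ of $Q$ consists of an orthonormal basis $(e_k)_{k\in\mathbb{N}}$ of $Y$ with $Qe_k = \lambda_k e_k$, $\lambda_k > 0$. "$KK^*$ is diagonalizable with respect to $(e_k)$" means every $e_k$ is an eigenvector of $KK^*$. "Lipschitz continuous on bounded sets" means: for every $r > 0$ there is $L = L(r) > 0$ that is a Lipschitz constant on the open ball $B_r(0)$. *)

theory Defs
  imports "HOL-Analysis.Analysis"
begin

text \<open>
  Hilbert spaces are types of class real_inner and complete_space, so all scalars are real.
  Operators are plain functions carrying a bounded_linear (or linear) assumption, and the adjoint of
  an operator is the library constant adjoint, which for bounded operators on a Hilbert space is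
  determined by the Riesz representation theorem.
\<close>

text \<open>No countability is built in; the basis may also be finite or empty.\<close>

definition orthonormal_basis :: "'a::real_inner set \<Rightarrow> bool" where
  "orthonormal_basis B \<longleftrightarrow>
     (\<forall>b\<in>B. norm b = 1) \<and> pairwise orthogonal B \<and> closure (span B) = UNIV"

definition self_adjoint_op :: "('a::real_inner \<Rightarrow> 'a) \<Rightarrow> bool" where
  "self_adjoint_op T \<longleftrightarrow> bounded_linear T \<and> (\<forall>x y. T x \<bullet> y = x \<bullet> T y)"

definition positive_op :: "('a::real_inner \<Rightarrow> 'a) \<Rightarrow> bool" where
  "positive_op T \<longleftrightarrow> bounded_linear T \<and> (\<forall>x. 0 \<le> T x \<bullet> x)"

text \<open>The square root of a self-adjoint positive bounded operator on a Hilbert space is its unique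
  self-adjoint positive bounded square root.\<close>

definition op_sqrt :: "('a::real_inner \<Rightarrow> 'a) \<Rightarrow> 'a \<Rightarrow> 'a" where
  "op_sqrt T = (THE R. self_adjoint_op R \<and> positive_op R \<and> R \<circ> R = T)"

text \<open>For injective T, this is the inverse of the square root. As an operator it is only defined on
  range (op_sqrt T); the values elsewhere are arbitrary.\<close>

definition op_inv_sqrt :: "('a::real_inner \<Rightarrow> 'a) \<Rightarrow> 'a \<Rightarrow> 'a" where
  "op_inv_sqrt T = inv (op_sqrt T)"

definition op_abs :: "('a::real_inner \<Rightarrow> 'a) \<Rightarrow> 'a \<Rightarrow> 'a" where
  "op_abs T = op_sqrt (adjoint T \<circ> T)"

definition compact_op :: "('a::real_normed_vector \<Rightarrow> 'b::real_normed_vector) \<Rightarrow> bool" where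
  "compact_op T \<longleftrightarrow> linear T \<and> (\<forall>S. bounded S \<longrightarrow> compact (closure (T ` S)))"

text \<open>In the next three definitions neither the convergence nor the value of the sum depends on the
  choice of the orthonormal basis.\<close>

definition trace_class_op :: "('a::real_inner \<Rightarrow> 'a) \<Rightarrow> bool" where
  "trace_class_op T \<longleftrightarrow> bounded_linear T \<and>
     (\<exists>B. orthonormal_basis B \<and> (\<lambda>b. op_abs T b \<bullet> b) summable_on B)"

definition hilbert_schmidt_op :: "('a::real_inner \<Rightarrow> 'b::real_inner) \<Rightarrow> bool" where
  "hilbert_schmidt_op T \<longleftrightarrow> bounded_linear T \<and>
     (\<exists>B. orthonormal_basis B \<and> (\<lambda>b. (norm (T b))\<^sup>2) summable_on B)"

definition hs_norm :: "('a::real_inner \<Rightarrow> 'b::real_inner) \<Rightarrow> real" where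
  "hs_norm T = sqrt (\<Sum>\<^sub>\<infinity>b\<in>(SOME B. orthonormal_basis B). (norm (T b))\<^sup>2)"

text \<open>Eigenpairs are indexed from 0. Injectivity of e makes the sequence itself orthonormal, and
  not just its range.\<close>

definition eigensystem ::
  "('b::real_inner \<Rightarrow> 'b) \<Rightarrow> (nat \<Rightarrow> real) \<Rightarrow> (nat \<Rightarrow> 'b) \<Rightarrow> bool" where
  "eigensystem Q lam e \<longleftrightarrow> inj e \<and> orthonormal_basis (range e) \<and>
     (\<forall>k. Q (e k) = lam k *\<^sub>R e k \<and> lam k > 0)"

definition diagonalizable_wrt ::
  "('b::real_inner \<Rightarrow> 'b) \<Rightarrow> (nat \<Rightarrow> 'b) \<Rightarrow> bool" where
  "diagonalizable_wrt T e \<longleftrightarrow> (\<forall>k. e k \<noteq> 0 \<and> (\<exists>\<mu>. T (e k) = \<mu> *\<^sub>R e k))"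

definition Phi_term ::
  "('a \<Rightarrow> 'b::real_inner) \<Rightarrow> (nat \<Rightarrow> real) \<Rightarrow> (nat \<Rightarrow> 'b) \<Rightarrow> 'a \<Rightarrow> 'b \<Rightarrow> nat \<Rightarrow> real" where
  "Phi_term K lam e u y k =
     (\<bar>y \<bullet> e k - K u \<bullet> e k\<bar> - \<bar>y \<bullet> e k\<bar>) / sqrt (lam k)"

definition Phi ::
  "('a \<Rightarrow> 'b::real_inner) \<Rightarrow> (nat \<Rightarrow> real) \<Rightarrow> (nat \<Rightarrow> 'b) \<Rightarrow> 'a \<Rightarrow> 'b \<Rightarrow> real" where
  "Phi K lam e u y = sqrt 2 * (\<Sum>k. Phi_term K lam e u y k)"

definition lipschitz_on_bounded_sets ::
  "('a::real_normed_vector \<Rightarrow> real) \<Rightarrow> bool" where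
  "lipschitz_on_bounded_sets f \<longleftrightarrow> (\<forall>r>0. \<exists>L>0. L-lipschitz_on (ball 0 r) f)"

end

theory Submission
  imports Defs
begin

text \<open>
  Put T = Q^(-1/2) K and g k = T* (e k), that is, K* (e k) / sqrt (lam k). By the reverse triangle
  inequality, the k-th terms of Phi at u and v differ by at most the absolute value of the inner
  product of u - v with g k. As the e k are eigenvectors of K K*, the g k are pairwise orthogonal.
  Pythagoras applied to a signed sum of the g k then bounds the sum of these absolute values by
  norm (u - v) times the square root of the sum of the (norm (g k))^2, which is the Hilbert--Schmidt
  norm of T* and hence of T.
\<close>

section \<open>Orthogonal series and orthonormal expansions\<close>

text \<open>By Pythagoras, the squared distance between nested partial sums of \<open>f\<close> is a
  difference of partial sums of the squared norms. The net of partial sums is therefore Cauchy, and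
  completeness gives the limit.\<close>

lemma summable_on_orthogonal:
  fixes f :: "'i \<Rightarrow> 'a::{real_inner, complete_space}"
  assumes orth: "pairwise (\<lambda>i j. orthogonal (f i) (f j)) A"
    and sq: "(\<lambda>i. (norm (f i))\<^sup>2) summable_on A"
  shows "f summable_on A"
proof -
  obtain S where S: "((\<lambda>i. (norm (f i))\<^sup>2) has_sum S) A"
    using sq summable_on_def by blast
  have "\<exists>P. eventually P (finite_subsets_at_top A) \<and>
      (\<forall>F F'. P F \<and> P F' \<longrightarrow> dist (sum f F) (sum f F') < \<epsilon>)" if "\<epsilon> > 0" for \<epsilon>
  proof -
    \<comment> \<open>Squared norms are compared below, so a distance of \<epsilon> / 2 between
      nested sums corresponds to \<open>d\<close>; each of the two sums has to be within
      \<open>d / 2\<close> of \<open>S\<close>.\<close>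
    define d where "d = (\<epsilon> / 2)\<^sup>2"
    have "d > 0" using that by (simp add: d_def)
    have "eventually (\<lambda>F. dist (\<Sum>i\<in>F. (norm (f i))\<^sup>2) S < d / 2) (finite_subsets_at_top A)"
      using S \<open>d > 0\<close> unfolding has_sum_def tendsto_iff by (blast intro: half_gt_zero)
    then obtain F0 where F0: "finite F0" "F0 \<subseteq> A"
      and close: "\<forall>F. finite F \<and> F0 \<subseteq> F \<and> F \<subseteq> A \<longrightarrow> dist (\<Sum>i\<in>F. (norm (f i))\<^sup>2) S < d / 2"
      unfolding eventually_finite_subsets_at_top by (elim exE conjE)
    have step: "dist (sum f G) (sum f F) < \<epsilon> / 2"
      if "finite G" "F0 \<subseteq> F" "F \<subseteq> G" "G \<subseteq> A" for F G
    proof -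
      have "finite F" using that finite_subset by blast
      have "(dist (sum f G) (sum f F))\<^sup>2 = (norm (sum f (G - F)))\<^sup>2"
        using that by (simp add: dist_norm sum_diff)
      also have "\<dots> = (\<Sum>i\<in>G - F. (norm (f i))\<^sup>2)"
        using that orth by (intro norm_sum_Pythagorean) (auto intro: pairwise_subset)
      also have "\<dots> = (\<Sum>i\<in>G. (norm (f i))\<^sup>2) - (\<Sum>i\<in>F. (norm (f i))\<^sup>2)"
        using that by (simp add: sum_diff)
      also have "\<dots> < d"
      proof -
        have "dist (\<Sum>i\<in>G. (norm (f i))\<^sup>2) S < d / 2" "dist (\<Sum>i\<in>F. (norm (f i))\<^sup>2) S < d / 2"
          using close that \<open>finite F\<close> by auto
        then show ?thesis unfolding dist_real_def by linarith
      qed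
      finally show ?thesis
        unfolding d_def using \<open>\<epsilon> > 0\<close> by (meson less_imp_le half_gt_zero power_less_imp_less_base)
    qed
    define P where "P F \<longleftrightarrow> finite F \<and> F0 \<subseteq> F \<and> F \<subseteq> A" for F
    have "eventually P (finite_subsets_at_top A)"
      unfolding eventually_finite_subsets_at_top P_def using F0 by blast
    moreover have "dist (sum f F) (sum f F') < \<epsilon>" if "P F" "P F'" for F F'
    proof -
      \<comment> \<open>The sets \<open>F\<close> and \<open>F'\<close> need not be nested, but both
        lie in their union, to which \<open>step\<close> applies twice.\<close>
      have "dist (sum f F) (sum f F') \<le> dist (sum f (F \<union> F')) (sum f F) + dist (sum f (F \<union> F')) (sum f F')"
        by (rule dist_triangle3)
      also have "\<dots> < \<epsilon> / 2 + \<epsilon> / 2"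
        using that unfolding P_def by (intro add_strict_mono step) auto
      finally show ?thesis by simp
    qed
    ultimately show ?thesis by blast
  qed
  then have "cauchy_filter (filtermap (sum f) (finite_subsets_at_top A))"
    by (simp add: cauchy_filter_metric_filtermap)
  \<comment> \<open>Convergence of Cauchy sequences is restated as completeness of
    \<open>UNIV\<close>, which \<open>complete_uniform\<close> carries over to Cauchy
    filters.\<close>
  moreover have "complete (UNIV::'a set)"
    by (meson Cauchy_convergent UNIV_I complete_def convergent_def)
  ultimately obtain L where "(sum f \<longlongrightarrow> L) (finite_subsets_at_top A)"
    using complete_uniform[where S=UNIV] by (force simp add: filterlim_def)
  then show ?thesis
    using summable_on_def has_sum_def by blast
qed

lemma orthonormal_basis_inner:
  assumes "orthonormal_basis B" "b \<in> B" "c \<in> B"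
  shows "b \<bullet> c = (if b = c then 1 else 0)"
  using assms unfolding orthonormal_basis_def pairwise_def orthogonal_def
  by (auto simp: dot_square_norm)

text \<open>The partial sum over \<open>F\<close> is the orthogonal projection of \<open>x\<close>
  onto \<open>span F\<close>, hence at least as close to \<open>x\<close> as any other vector there.
  Density of \<open>span B\<close> provides a vector \<open>y\<close> within \<epsilon> of
  \<open>x\<close>, and \<open>y\<close> stays in \<open>span F\<close> once \<open>F\<close>
  contains its finite support.\<close>

lemma orthonormal_basis_expansion:
  fixes x :: "'a::real_inner"
  assumes B: "orthonormal_basis B"
  shows "((\<lambda>b. (x \<bullet> b) *\<^sub>R b) has_sum x) B"
  unfolding has_sum_def tendsto_iff
proof (intro allI impI)
  fix \<epsilon> :: real assume "\<epsilon> > 0"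
  have "x \<in> closure (span B)" using B by (simp add: orthonormal_basis_def)
  then obtain y where y: "y \<in> span B" "dist y x < \<epsilon>"
    using \<open>\<epsilon> > 0\<close> closure_approachable by blast
  then obtain F0 r where F0: "finite F0" "F0 \<subseteq> B" and yF0: "y = (\<Sum>b\<in>F0. r b *\<^sub>R b)"
    unfolding span_explicit by blast
  have "y \<in> span F0"
    unfolding yF0 by (intro span_sum span_scale span_base)
  have "dist (\<Sum>b\<in>F. (x \<bullet> b) *\<^sub>R b) x < \<epsilon>" if F: "finite F" "F0 \<subseteq> F" "F \<subseteq> B" for F
  proof -
    define p where "p = (\<Sum>b\<in>F. (x \<bullet> b) *\<^sub>R b)"
    have "p \<in> span F"
      unfolding p_def by (intro span_sum span_scale span_base)
    moreover have "y \<in> span F" using \<open>y \<in> span F0\<close> F span_mono by blast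
    ultimately have "p - y \<in> span F" by (rule span_diff)
    have "orthogonal (x - p) c" if "c \<in> F" for c
    proof -
      have "p \<bullet> c = (\<Sum>b\<in>F. (x \<bullet> b) * (if b = c then 1 else 0))"
        unfolding p_def inner_sum_left
        using F that by (intro sum.cong) (auto simp: orthonormal_basis_inner[OF B] subset_iff)
      also have "\<dots> = x \<bullet> c" using F that by (simp add: if_distrib cong: if_cong)
      finally show ?thesis by (simp add: orthogonal_def inner_diff_left)
    qed
    then have "orthogonal (x - p) (p - y)"
      using \<open>p - y \<in> span F\<close> orthogonal_to_span by blast
    then have "(norm (x - p + (p - y)))\<^sup>2 = (norm (x - p))\<^sup>2 + (norm (p - y))\<^sup>2"
      by (rule norm_add_Pythagorean)
    then have "(norm (x - p))\<^sup>2 \<le> (norm (x - y))\<^sup>2" by simp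
    then have "norm (x - p) \<le> norm (x - y)" by (rule power2_le_imp_le) simp
    then show ?thesis using y unfolding p_def by (simp add: dist_norm norm_minus_commute)
  qed
  then show "\<forall>\<^sub>F F in finite_subsets_at_top B. dist (\<Sum>b\<in>F. (x \<bullet> b) *\<^sub>R b) x < \<epsilon>"
    unfolding eventually_finite_subsets_at_top using F0 by blast
qed

lemma parseval_inner:
  assumes "orthonormal_basis B"
  shows "((\<lambda>b. (x \<bullet> b) * (y \<bullet> b)) has_sum x \<bullet> y) B"
  using has_sum_bounded_linear[OF bounded_linear_inner_right orthonormal_basis_expansion[OF assms], of y x]
  by (simp add: inner_commute[of y x])

lemma parseval_norm:
  assumes "orthonormal_basis B"
  shows "((\<lambda>b. (x \<bullet> b)\<^sup>2) has_sum (norm x)\<^sup>2) B"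
  using parseval_inner[OF assms, of x x] by (simp add: power2_eq_square dot_square_norm)

lemma orthonormal_basis_eqI:
  assumes B: "orthonormal_basis B" and eq: "\<And>b. b \<in> B \<Longrightarrow> x \<bullet> b = y \<bullet> b"
  shows "x = y"
proof -
  have "((\<lambda>b. (x \<bullet> b) *\<^sub>R b) has_sum y) B"
    using orthonormal_basis_expansion[OF B, of y] by (simp add: eq cong: has_sum_cong)
  then show ?thesis
    using orthonormal_basis_expansion[OF B, of x] has_sum_unique by blast
qed

lemma riesz_fischer:
  fixes B :: "'a::{real_inner, complete_space} set"
  assumes B: "orthonormal_basis B" and c: "(\<lambda>b. (c b)\<^sup>2) summable_on B"
  shows "(\<lambda>b. c b *\<^sub>R b) summable_on B"
proof (rule summable_on_orthogonal)
  show "pairwise (\<lambda>b b'. orthogonal (c b *\<^sub>R b) (c b' *\<^sub>R b')) B"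
    using B unfolding orthonormal_basis_def pairwise_def orthogonal_def by simp
  have "(norm (c b *\<^sub>R b))\<^sup>2 = (c b)\<^sup>2" if "b \<in> B" for b
    using B that by (simp add: orthonormal_basis_def)
  then show "(\<lambda>b. (norm (c b *\<^sub>R b))\<^sup>2) summable_on B"
    using c by (simp cong: summable_on_cong)
qed

section \<open>Riesz representation and adjoints\<close>

text \<open>The coefficients of the representing vector can only be the values \<open>f b\<close>.
  Their square-summability comes from testing \<open>f\<close> on \<open>v\<close>, the finite sum
  of the \<open>f b *\<^sub>R b\<close>: there \<open>f v\<close> equals the squared norm of
  \<open>v\<close> and is at most \<open>norm v * M\<close>.\<close>

lemma riesz_representation:
  fixes f :: "'a::{real_inner, complete_space} \<Rightarrow> real"
  assumes B: "orthonormal_basis (B :: 'a set)" and f: "bounded_linear f"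
  obtains a where "\<And>x. f x = x \<bullet> a"
proof -
  interpret f: bounded_linear f by fact
  obtain M where M: "\<And>x. norm (f x) \<le> norm x * M" using f.bounded by blast
  have "(\<Sum>b\<in>F. (f b)\<^sup>2) \<le> M\<^sup>2" if F: "finite F" "F \<subseteq> B" for F
  proof -
    define v where "v = (\<Sum>b\<in>F. f b *\<^sub>R b)"
    have nv: "(norm v)\<^sup>2 = (\<Sum>b\<in>F. (norm (f b *\<^sub>R b))\<^sup>2)"
      unfolding v_def using F B
      by (intro norm_sum_Pythagorean) (auto simp: orthonormal_basis_def pairwise_def orthogonal_def subset_iff)
    also have "\<dots> = (\<Sum>b\<in>F. (f b)\<^sup>2)"
      using F B by (intro sum.cong) (auto simp: orthonormal_basis_def)
    also have "\<dots> = f v"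
      unfolding v_def by (simp add: f.sum f.scale power2_eq_square)
    also have "\<dots> \<le> norm v * M" using M[of v] by simp
    finally have le: "norm v * norm v \<le> norm v * M" by (simp add: power2_eq_square)
    have "(norm v)\<^sup>2 \<le> M\<^sup>2"
    \<comment> \<open>Cancelling \<open>norm v\<close> requires \<open>v\<close> to be nonzero; for
      \<open>v = 0\<close> the bound is a square and holds trivially.\<close>
    proof (cases "v = 0")
      case False
      then have "norm v \<le> M" using le by simp
      then show ?thesis by (simp add: power_mono)
    qed simp
    then show ?thesis
      using nv F B by (simp add: orthonormal_basis_def subset_iff)
  qed
  then have "(\<lambda>b. (f b)\<^sup>2) summable_on B"
    by (intro nonneg_bdd_above_summable_on bdd_aboveI[of _ "M\<^sup>2"]) auto
  then obtain a where a: "((\<lambda>b. f b *\<^sub>R b) has_sum a) B"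
    using riesz_fischer[OF B] summable_on_def by blast
  have "f x = x \<bullet> a" for x
  proof -
    have "((\<lambda>b. (x \<bullet> b) * f b) has_sum f x) B"
      using has_sum_bounded_linear[OF f orthonormal_basis_expansion[OF B], of x] by (simp add: f.scale)
    moreover have "((\<lambda>b. (x \<bullet> b) * f b) has_sum x \<bullet> a) B"
      using has_sum_bounded_linear[OF bounded_linear_inner_right a, of x] by (simp add: mult.commute)
    ultimately show ?thesis using has_sum_unique by blast
  qed
  then show thesis using that by blast
qed

text \<open>The library's adjoint_works assumes a finite-dimensional domain.\<close>

lemma adjoint_hilbert:
  fixes T :: "'a::{real_inner, complete_space} \<Rightarrow> 'b::real_inner"
  assumes B: "orthonormal_basis (B :: 'a set)" and T: "bounded_linear T"
  shows "T x \<bullet> y = x \<bullet> adjoint T y"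
proof -
  have "\<exists>a. \<forall>x. T x \<bullet> y = x \<bullet> a" for y
    using riesz_representation[OF B bounded_linear_compose[OF bounded_linear_inner_left T], of y]
    by (metis (no_types, lifting))
  \<comment> \<open>\<open>adjoint\<close> is a Hilbert choice of a function with this property, so
    existence of one suffices.\<close>
  then have "\<exists>T'. \<forall>x y. T x \<bullet> y = x \<bullet> T' y" by metis
  then show ?thesis
    unfolding adjoint_def by (rule someI2_ex) simp
qed

section \<open>Hilbert--Schmidt sums and orthogonal families\<close>

text \<open>Both sums equal the sum of the squared matrix entries.\<close>

lemma hilbert_schmidt_sum_transpose:
  assumes B: "orthonormal_basis B" and E: "orthonormal_basis E"
    and adj: "\<And>x y. x \<in> B \<Longrightarrow> y \<in> E \<Longrightarrow> T x \<bullet> y = x \<bullet> T' y"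
    and S: "((\<lambda>b. (norm (T b))\<^sup>2) has_sum S) B"
  shows "((\<lambda>k. (norm (T' k))\<^sup>2) has_sum S) E"
proof -
  define m where "m = (\<lambda>(b, k). (T b \<bullet> k)\<^sup>2)"
  have row: "((\<lambda>k. m (b, k)) has_sum (norm (T b))\<^sup>2) E" for b
    unfolding m_def using parseval_norm[OF E, of "T b"] by simp
  \<comment> \<open>The entries are nonnegative, so summability of the row sums gives summability
    over the product, where the order of summation can be exchanged.\<close>
  have "m summable_on B \<times> E"
    using S by (intro summable_on_SigmaI[where B = "\<lambda>_. E", OF row]) (auto simp: m_def summable_on_def)
  then have "(m has_sum S) (B \<times> E)"
    using has_sum_SigmaI[OF row S] by blast
  then have "((\<lambda>(k, b). m (b, k)) has_sum S) (E \<times> B)"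
    by (rule has_sum_swap[THEN iffD1])
  moreover have "((\<lambda>b. (case (k, b) of (k, b) \<Rightarrow> m (b, k))) has_sum (norm (T' k))\<^sup>2) B" if "k \<in> E" for k
    using parseval_norm[OF B, of "T' k"] that adj
    by (simp add: m_def inner_commute cong: has_sum_cong)
  ultimately show ?thesis
    by (rule has_sum_SigmaD)
qed

text \<open>Cauchy--Schwarz on each term would leave the sum of the \<open>norm (g i)\<close>, which
  square-summability does not control uniformly in \<open>F\<close>. Orthogonality replaces it by
  the l2 norm.\<close>

lemma sum_abs_inner_orthogonal_le:
  fixes g :: "'i \<Rightarrow> 'a::real_inner"
  assumes "finite F" and orth: "pairwise (\<lambda>i j. orthogonal (g i) (g j)) F"
  shows "(\<Sum>i\<in>F. \<bar>h \<bullet> g i\<bar>) \<le> sqrt (\<Sum>i\<in>F. (norm (g i))\<^sup>2) * norm h"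
proof -
  \<comment> \<open>With the right signs, the sum becomes a single inner product.\<close>
  define s where "s i = sgn (h \<bullet> g i)" for i
  define v where "v = (\<Sum>i\<in>F. s i *\<^sub>R g i)"
  have "(norm v)\<^sup>2 = (\<Sum>i\<in>F. (norm (s i *\<^sub>R g i))\<^sup>2)"
    unfolding v_def using assms
    by (intro norm_sum_Pythagorean) (auto simp: pairwise_def orthogonal_def)
  also have "\<dots> \<le> (\<Sum>i\<in>F. (norm (g i))\<^sup>2)"
    by (intro sum_mono power_mono) (auto simp: s_def abs_sgn_eq mult_left_le_one_le)
  finally have nv: "norm v \<le> sqrt (\<Sum>i\<in>F. (norm (g i))\<^sup>2)" by (rule real_le_rsqrt)
  have "(\<Sum>i\<in>F. \<bar>h \<bullet> g i\<bar>) = h \<bullet> v"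
    unfolding v_def inner_sum_right by (simp add: s_def abs_sgn mult.commute)
  also have "\<dots> \<le> norm h * norm v" by (rule norm_cauchy_schwarz)
  also have "\<dots> \<le> norm h * sqrt (\<Sum>i\<in>F. (norm (g i))\<^sup>2)"
    by (intro mult_left_mono nv) simp
  finally show ?thesis by (simp add: mult.commute)
qed

section \<open>Square roots of diagonal positive operators\<close>

lemma positive_sqrt_eigenvector:
  assumes R: "self_adjoint_op R" "positive_op R" "R (R x) = \<mu> *\<^sub>R x" and "\<mu> > 0"
  shows "R x = sqrt \<mu> *\<^sub>R x"
proof -
  interpret bounded_linear R using R by (simp add: self_adjoint_op_def)
  \<comment> \<open>(R + sqrt \<mu>) (R - sqrt \<mu>) x = 0, and R + sqrt \<mu> is injective since R is positive.\<close>
  define v where "v = R x - sqrt \<mu> *\<^sub>R x"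
  have "R v = - sqrt \<mu> *\<^sub>R v"
    using R(3) \<open>\<mu> > 0\<close> by (simp add: v_def diff scale scaleR_diff_right)
  moreover have "0 \<le> R v \<bullet> v" using R by (simp add: positive_op_def)
  ultimately have "sqrt \<mu> * (v \<bullet> v) \<le> 0" by simp
  then have "v \<bullet> v \<le> 0" using \<open>\<mu> > 0\<close> by (simp add: mult_le_0_iff)
  then have "v = 0" by (metis inner_ge_zero inner_eq_zero_iff order_antisym)
  then show ?thesis by (simp add: v_def)
qed

text \<open>The root acts diagonally, multiplying the coordinate at \<open>b\<close> by
  \<open>sqrt (\<mu> b)\<close>. The series converges by Riesz--Fischer, since by Parseval its
  squared coefficients sum to \<open>Q x \<bullet> x\<close>.\<close>

lemma positive_sqrt_exists:
  fixes Q :: "'b::{real_inner, complete_space} \<Rightarrow> 'b"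
  assumes Q: "self_adjoint_op Q" and B: "orthonormal_basis B"
    and eig: "\<And>b. b \<in> B \<Longrightarrow> Q b = \<mu> b *\<^sub>R b" and pos: "\<And>b. b \<in> B \<Longrightarrow> \<mu> b > 0"
  obtains R where "self_adjoint_op R" "positive_op R" "R \<circ> R = Q"
proof -
  have sQ: "Q x \<bullet> y = x \<bullet> Q y" for x y using Q by (simp add: self_adjoint_op_def)
  interpret Q: bounded_linear Q using Q by (simp add: self_adjoint_op_def)
  define R where "R x = (\<Sum>\<^sub>\<infinity>b\<in>B. (sqrt (\<mu> b) * (x \<bullet> b)) *\<^sub>R b)" for x
  have sq: "(sqrt (\<mu> b) * (x \<bullet> b))\<^sup>2 = (Q x \<bullet> b) * (x \<bullet> b)" if "b \<in> B" for x b
    using pos[OF that] by (simp add: sQ eig[OF that] power_mult_distrib power2_eq_square)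
  have hsR: "((\<lambda>b. (sqrt (\<mu> b) * (x \<bullet> b)) *\<^sub>R b) has_sum R x) B" for x
  proof -
    have "(\<lambda>b. (sqrt (\<mu> b) * (x \<bullet> b))\<^sup>2) summable_on B"
      using parseval_inner[OF B, of "Q x" x] by (auto simp: sq summable_on_def cong: has_sum_cong)
    from riesz_fischer[OF B this] show ?thesis unfolding R_def by (rule has_sum_infsum)
  qed
  have Rin: "((\<lambda>b. (sqrt (\<mu> b) * (x \<bullet> b)) * (y \<bullet> b)) has_sum R x \<bullet> y) B" for x y
    using has_sum_bounded_linear[OF bounded_linear_inner_right hsR, of y x]
    by (simp add: inner_commute[of y "R x"])
  have sR: "R x \<bullet> y = x \<bullet> R y" for x y
  proof (rule has_sum_unique[OF Rin])
    show "((\<lambda>b. (sqrt (\<mu> b) * (x \<bullet> b)) * (y \<bullet> b)) has_sum x \<bullet> R y) B"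
      using Rin[of y x] by (simp add: inner_commute[of x "R y"] mult_ac)
  qed
  have Reig: "R b = sqrt (\<mu> b) *\<^sub>R b" if "b \<in> B" for b
  proof (rule orthonormal_basis_eqI[OF B])
    fix c assume "c \<in> B"
    \<comment> \<open>Only \<open>d = b\<close> contributes, so \<open>sqrt (\<mu> d)\<close> may be
      replaced by the constant \<open>sqrt (\<mu> b)\<close> before Parseval is applied.\<close>
    have "((\<lambda>d. (sqrt (\<mu> d) * (b \<bullet> d)) * (c \<bullet> d)) has_sum (sqrt (\<mu> b) *\<^sub>R b) \<bullet> c) B"
      using has_sum_scaleR[OF parseval_inner[OF B, of b c], of "sqrt (\<mu> b)"] that
      by (auto simp: orthonormal_basis_inner[OF B] elim!: has_sum_cong[THEN iffD1, rotated])
    then show "R b \<bullet> c = (sqrt (\<mu> b) *\<^sub>R b) \<bullet> c"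
      using Rin has_sum_unique by blast
  qed
  have RR: "R (R x) = Q x" for x
  proof (rule orthonormal_basis_eqI[OF B])
    fix b assume "b \<in> B"
    then show "R (R x) \<bullet> b = Q x \<bullet> b"
      using pos[of b] by (simp add: sR sQ Reig eig)
  qed
  have "bounded_linear R"
  proof -
    \<comment> \<open>Symmetry moves \<open>R\<close> onto the basis vector, leaving an expression
      visibly linear in the argument.\<close>
    have add: "R (x + y) = R x + R y" for x y
      by (rule orthonormal_basis_eqI[OF B]) (simp add: sR inner_add_left)
    have scale: "R (r *\<^sub>R x) = r *\<^sub>R R x" for r x
      by (rule orthonormal_basis_eqI[OF B]) (simp add: sR)
    obtain M where M: "\<And>x. norm (Q x) \<le> norm x * M" "M > 0" using Q.pos_bounded by blast
    have "norm (R x) \<le> norm x * sqrt M" for x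
    proof (rule power2_le_imp_le)
      have "(norm (R x))\<^sup>2 = Q x \<bullet> x"
        by (simp add: dot_square_norm[symmetric] sR RR inner_commute)
      also have "\<dots> \<le> norm (Q x) * norm x" by (rule norm_cauchy_schwarz)
      also have "\<dots> \<le> (norm x * M) * norm x" by (intro mult_right_mono M) simp
      also have "\<dots> = (norm x * sqrt M)\<^sup>2"
        using M(2) by (simp add: power_mult_distrib) (simp add: power2_eq_square)
      finally show "(norm (R x))\<^sup>2 \<le> (norm x * sqrt M)\<^sup>2" .
    qed (use M in auto)
    then show ?thesis using add scale by (intro bounded_linear_intro)
  qed
  moreover have "0 \<le> R x \<bullet> x" for x
    using pos by (intro has_sum_nonneg[OF Rin]) (simp add: mult.assoc less_imp_le)
  moreover have "R \<circ> R = Q" using RR by auto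
  ultimately show thesis
    using sR by (intro that[of R]) (auto simp: self_adjoint_op_def positive_op_def)
qed

text \<open>\<open>op_sqrt\<close> is a definite description, so it is usable only after existence
  and uniqueness. Any two candidates take the same values on the eigenbasis, and self-adjointness
  turns this into equality of all coordinates of \<open>R x\<close> and \<open>R' x\<close>.\<close>

lemma op_sqrt_properties:
  fixes Q :: "'b::{real_inner, complete_space} \<Rightarrow> 'b"
  assumes Q: "self_adjoint_op Q" and B: "orthonormal_basis B"
    and eig: "\<And>b. b \<in> B \<Longrightarrow> Q b = \<mu> b *\<^sub>R b" and pos: "\<And>b. b \<in> B \<Longrightarrow> \<mu> b > 0"
  shows "self_adjoint_op (op_sqrt Q)"
    "\<And>b. b \<in> B \<Longrightarrow> op_sqrt Q b = sqrt (\<mu> b) *\<^sub>R b"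
proof -
  let ?P = "\<lambda>R. self_adjoint_op R \<and> positive_op R \<and> R \<circ> R = Q"
  have eigR: "R b = sqrt (\<mu> b) *\<^sub>R b" if "?P R" "b \<in> B" for R b
  proof (rule positive_sqrt_eigenvector)
    show "R (R b) = \<mu> b *\<^sub>R b" using that eig by (metis comp_apply)
  qed (use that pos in auto)
  have unique: "R = R'" if "?P R" "?P R'" for R R'
  proof
    fix x
    show "R x = R' x"
    proof (rule orthonormal_basis_eqI[OF B])
      fix b assume "b \<in> B"
      then show "R x \<bullet> b = R' x \<bullet> b"
        using that eigR[OF that(1)] eigR[OF that(2)] by (simp add: self_adjoint_op_def)
    qed
  qed
  obtain R where "?P R" using positive_sqrt_exists[OF Q B eig pos] by blast
  have "\<exists>!R. ?P R"
  proof (rule ex1I[of ?P R])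
    show "?P R" by fact
    show "R' = R" if "?P R'" for R' using unique[OF that \<open>?P R\<close>] .
  qed
  then have P: "?P (op_sqrt Q)"
    unfolding op_sqrt_def by (rule theI'[of ?P])
  then show "self_adjoint_op (op_sqrt Q)" by blast
  show "op_sqrt Q b = sqrt (\<mu> b) *\<^sub>R b" if "b \<in> B" for b using eigR[OF P that] .
qed

section \<open>Boundedness of compact operators and the Lipschitz estimate\<close>

text \<open>The image of the closed unit ball lies in a compact set, hence is bounded; scaling
  extends the bound to all vectors.\<close>

lemma compact_op_bounded_linear:
  assumes "compact_op T"
  shows "bounded_linear T"
proof -
  have "linear T" and "compact (closure (T ` cball 0 1))"
    using assms by (auto simp: compact_op_def)
  then have "bounded (T ` cball 0 1)"
    using bounded_subset[OF compact_imp_bounded closure_subset] by blast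
  then obtain M where M: "\<And>x. norm x \<le> 1 \<Longrightarrow> norm (T x) \<le> M"
    by (fastforce simp: bounded_iff)
  interpret linear T by fact
  have "norm (T x) \<le> norm x * M" for x
  proof (cases "x = 0")
    case False
    have "norm (T x) = norm x * norm (T (x /\<^sub>R norm x))"
      using False by (simp add: scale)
    also have "\<dots> \<le> norm x * M" using False by (intro mult_left_mono M) auto
    finally show ?thesis .
  qed simp
  then show ?thesis using \<open>linear T\<close> by (simp add: bounded_linear_def bounded_linear_axioms_def) blast
qed

theorem proposition3p13:
  fixes Q :: "'b::{real_inner, complete_space} \<Rightarrow> 'b"
    and K :: "'a::{real_inner, complete_space} \<Rightarrow> 'b"
    and lam :: "nat \<Rightarrow> real" and e :: "nat \<Rightarrow> 'b"
  assumes "separable_space (euclidean :: 'a topology)"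
    and "separable_space (euclidean :: 'b topology)"
    and "inj Q" and "self_adjoint_op Q" and "positive_op Q" and "trace_class_op Q"
    and "eigensystem Q lam e"
    and "compact_op K"
    and "diagonalizable_wrt (K \<circ> adjoint K) e"
    and "range K \<subseteq> range (op_sqrt Q)"
    and "hilbert_schmidt_op (op_inv_sqrt Q \<circ> K)"
  shows "(\<forall>u y. summable (Phi_term K lam e u y)) \<and>
    (\<forall>y. (sqrt 2 * hs_norm (op_inv_sqrt Q \<circ> K))-lipschitz_on UNIV (\<lambda>u. Phi K lam e u y)) \<and>
    (\<forall>y. lipschitz_on_bounded_sets (\<lambda>u. Phi K lam e u y) \<and>
      (\<exists>L\<ge>0. \<forall>u. Phi K lam e u y \<ge> Phi K lam e 0 y - L * norm u))"
proof -
  define T where "T = op_inv_sqrt Q \<circ> K"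
  define C where "C = hs_norm T"
  have inj_e: "inj e" and E: "orthonormal_basis (range e)"
    and lam: "\<And>k. Q (e k) = lam k *\<^sub>R e k" "\<And>k. lam k > 0"
    using assms(7) by (auto simp: eigensystem_def)
  \<comment> \<open>The lemmas on square roots index eigenvalues by basis vectors; injectivity of
    \<open>e\<close> recovers the index.\<close>
  define \<mu> where "\<mu> b = lam (inv e b)" for b
  have \<mu>: "\<mu> (e k) = lam k" for k by (simp add: \<mu>_def inj_e)
  have Q_eig: "Q b = \<mu> b *\<^sub>R b" "\<mu> b > 0" if "b \<in> range e" for b
    using that lam \<mu> by auto
  note sqrtQ = op_sqrt_properties[OF assms(4) E Q_eig]
  \<comment> \<open>The range inclusion keeps \<open>op_inv_sqrt Q\<close> away from its arbitrary
    values.\<close>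
  have sqrt_T: "op_sqrt Q (T u) = K u" for u
    using assms(10) by (simp add: T_def op_inv_sqrt_def f_inv_into_f image_subset_iff)
  have K_T: "K u \<bullet> e k = sqrt (lam k) * (T u \<bullet> e k)" for u k
  proof -
    have "K u \<bullet> e k = T u \<bullet> op_sqrt Q (e k)"
      using sqrtQ(1) by (simp add: sqrt_T[symmetric] self_adjoint_op_def)
    then show ?thesis by (simp add: sqrtQ(2) \<mu>)
  qed
  obtain B S where B: "orthonormal_basis B" and S: "((\<lambda>b. (norm (T b))\<^sup>2) has_sum S) B"
    using assms(11) unfolding hilbert_schmidt_op_def T_def summable_on_def by blast
  have adj: "K x \<bullet> y = x \<bullet> adjoint K y" for x y
    using adjoint_hilbert[OF B compact_op_bounded_linear[OF assms(8)]] .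
  \<comment> \<open>Written with the adjoint of \<open>K\<close>, so that diagonalizability of
    \<open>K \<circ> adjoint K\<close> yields orthogonality directly.\<close>
  define g where "g k = adjoint K (e k) /\<^sub>R sqrt (lam k)" for k
  have T_g: "T u \<bullet> e k = u \<bullet> g k" for u k
    using K_T[of u k] adj[of u "e k"] lam(2)[of k] by (simp add: g_def field_simps)
  have orth: "orthogonal (g i) (g j)" if "i \<noteq> j" for i j
  proof -
    obtain \<nu> where "K (adjoint K (e i)) = \<nu> *\<^sub>R e i"
      using assms(9) by (auto simp: diagonalizable_wrt_def)
    moreover have "e i \<bullet> e j = 0"
      using that inj_e by (simp add: orthonormal_basis_inner[OF E] inj_eq)
    ultimately have "adjoint K (e i) \<bullet> adjoint K (e j) = 0"
      using adj[of "adjoint K (e i)" "e j"] by simp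
    then show ?thesis by (simp add: g_def orthogonal_def)
  qed
  have g_range: "((\<lambda>b. (norm (g (inv e b)))\<^sup>2) has_sum S) (range e)"
    by (rule hilbert_schmidt_sum_transpose[OF B E _ S]) (auto simp: inj_e T_g)
  then have g_S: "((\<lambda>k. (norm (g k))\<^sup>2) has_sum S) UNIV"
    using has_sum_reindex[OF inj_e, of "\<lambda>b. (norm (g (inv e b)))\<^sup>2" S] by (simp add: o_def inj_e)
  \<comment> \<open>\<open>hs_norm\<close> sums over a chosen basis, possibly other than
    \<open>B\<close>. Transposing twice carries the value \<open>S\<close> from \<open>B\<close> to
    the eigenbasis and from there to \<open>B0\<close>.\<close>
  define B0 :: "'a set" where "B0 = (SOME B. orthonormal_basis B)"
  have B0: "orthonormal_basis B0" unfolding B0_def using B by (rule someI)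
  have "((\<lambda>b. (norm (T b))\<^sup>2) has_sum S) B0"
    by (rule hilbert_schmidt_sum_transpose[OF E B0 _ g_range])
      (auto simp: inj_e T_g[symmetric] inner_commute)
  then have C: "C = sqrt S"
    unfolding C_def hs_norm_def B0_def[symmetric] by (simp add: infsumI)
  have bound: "(\<Sum>k<n. \<bar>h \<bullet> g k\<bar>) \<le> C * norm h" for n h
  proof -
    have "(\<Sum>k<n. \<bar>h \<bullet> g k\<bar>) \<le> sqrt (\<Sum>k<n. (norm (g k))\<^sup>2) * norm h"
      using orth by (intro sum_abs_inner_orthogonal_le) (auto simp: pairwise_def)
    also have "\<dots> \<le> sqrt S * norm h"
      by (intro mult_right_mono real_sqrt_le_mono finite_sum_le_has_sum[OF g_S]) auto
    finally show ?thesis using C by simp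
  qed
  have abs_summable: "summable (\<lambda>k. \<bar>h \<bullet> g k\<bar>)" and abs_suminf_le: "(\<Sum>k. \<bar>h \<bullet> g k\<bar>) \<le> C * norm h" for h
  proof -
    show "summable (\<lambda>k. \<bar>h \<bullet> g k\<bar>)"
      using bound by (intro summableI_nonneg_bounded) auto
    then show "(\<Sum>k. \<bar>h \<bullet> g k\<bar>) \<le> C * norm h"
      using bound by (intro suminf_le_const)
  qed
  have term_diff: "\<bar>Phi_term K lam e u y k - Phi_term K lam e v y k\<bar> \<le> \<bar>(u - v) \<bullet> g k\<bar>" for u v y k
  proof -
    have "\<bar>Phi_term K lam e u y k - Phi_term K lam e v y k\<bar> =
        \<bar>\<bar>y \<bullet> e k - K u \<bullet> e k\<bar> - \<bar>y \<bullet> e k - K v \<bullet> e k\<bar>\<bar> / sqrt (lam k)"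
      using lam(2)[of k] by (simp add: Phi_term_def diff_divide_distrib[symmetric])
    also have "\<dots> \<le> \<bar>K u \<bullet> e k - K v \<bullet> e k\<bar> / sqrt (lam k)"
      using lam(2)[of k] by (intro divide_right_mono) auto
    also have "\<dots> = \<bar>(u - v) \<bullet> g k\<bar>"
      using lam(2)[of k]
      by (simp add: K_T T_g right_diff_distrib[symmetric] inner_diff_left[symmetric] abs_mult)
    finally show ?thesis .
  qed
  have summable: "summable (Phi_term K lam e u y)" for u y
  proof (rule summable_comparison_test')
    interpret K: bounded_linear K by (rule compact_op_bounded_linear[OF assms(8)])
    fix k
    \<comment> \<open>The comparison point is 0, where every term vanishes because
      \<open>K 0 = 0\<close>.\<close>
    show "norm (Phi_term K lam e u y k) \<le> \<bar>u \<bullet> g k\<bar>"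
      using term_diff[of u y k 0] by (simp add: Phi_term_def K.zero)
  qed (rule abs_summable)
  have lipschitz: "(sqrt 2 * C)-lipschitz_on UNIV (\<lambda>u. Phi K lam e u y)" for y
  proof (rule lipschitz_onI)
    fix u v
    let ?d = "\<lambda>k. Phi_term K lam e u y k - Phi_term K lam e v y k"
    have abs_d: "summable (\<lambda>k. \<bar>?d k\<bar>)"
      using term_diff by (intro summable_comparison_test'[OF abs_summable[of "u - v"]]) auto
    have "dist (Phi K lam e u y) (Phi K lam e v y) = sqrt 2 * \<bar>\<Sum>k. ?d k\<bar>"
      by (simp add: Phi_def dist_real_def right_diff_distrib[symmetric] suminf_diff summable abs_mult)
    also have "\<dots> \<le> sqrt 2 * (\<Sum>k. \<bar>?d k\<bar>)"
      by (intro mult_left_mono summable_rabs abs_d) auto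
    also have "\<dots> \<le> sqrt 2 * (\<Sum>k. \<bar>(u - v) \<bullet> g k\<bar>)"
      by (intro mult_left_mono suminf_le term_diff abs_d abs_summable) auto
    also have "\<dots> \<le> sqrt 2 * (C * norm (u - v))"
      by (intro mult_left_mono abs_suminf_le) auto
    finally show "dist (Phi K lam e u y) (Phi K lam e v y) \<le> sqrt 2 * C * dist u v"
      by (simp add: dist_norm mult.assoc)
  next
    show "0 \<le> sqrt 2 * C"
      using has_sum_nonneg[OF g_S] by (simp add: C)
  qed
  have on_bounded: "lipschitz_on_bounded_sets (\<lambda>u. Phi K lam e u y)" for y
    unfolding lipschitz_on_bounded_sets_def
  proof (intro allI impI exI conjI)
    \<comment> \<open>A strictly positive constant is required, while \<open>C\<close> may be 0;
      adding 1 serves all radii at once.\<close>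
    show "sqrt 2 * C + 1 > 0" using lipschitz_on_nonneg[OF lipschitz[of y]] by linarith
    show "(sqrt 2 * C + 1)-lipschitz_on (ball 0 r) (\<lambda>u. Phi K lam e u y)" for r
      by (rule lipschitz_on_mono[OF lipschitz]) auto
  qed
  have lower: "\<exists>L\<ge>0. \<forall>u. Phi K lam e u y \<ge> Phi K lam e 0 y - L * norm u" for y
  proof (intro exI conjI allI)
    show "sqrt 2 * C \<ge> 0" by (rule lipschitz_on_nonneg[OF lipschitz[of y]])
    show "Phi K lam e u y \<ge> Phi K lam e 0 y - sqrt 2 * C * norm u" for u
      using lipschitz_onD[OF lipschitz[of y], of u 0] by (simp add: dist_real_def abs_le_iff)
  qed
  show ?thesis
    using summable lipschitz on_bounded lower unfolding C_def T_def by blast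
qed

end
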